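(* Let $k\ge 4$, let $\Gamma_{000\dots}$ be the Schreier graph of the action of the Hanoi Towers group $H^{(k)}$ on the orbit of the infinite word $000\dots$, and let $\gamma(n)$ be the number of vertices of $\Gamma_{000\dots}$ in the ball of radius $n$ centered at $000\dots$. Then the growth of $\Gamma_{000\dots}$ is intermediate. Moreover, there exist constants $b>a>1$ such that $$a^{(\log n)^{k-2}}\preceq\gamma(n)\preceq b^{(\log n)^{k-2}}.$$
   Context: Let $X=\{0,\dots,k-1\}$ and let $X^*$ be the set of finite words over $X$, viewed as a $k$-regular rooted tree $\mathcal{T}$ (the root is the empty word, level $n$ consists of the words of length $n$, and the children of $u$ are the words $ux$, $x\in X$). Its boundary $\partial\mathcal{T}$ is the set of infinite words over $X$; automorphisms of $\mathcal{T}$ act on $\partial\mathcal{T}$. For $0\le i<j\le k-1$ let $a_{(ij)}$ be the automorphism of $\mathcal{T}$ defined recursively by (fixing the empty word and) $$a_{(ij)}(iw)=jw,\qquad a_{(ij)}(jw)=iw,\qquad a_{(ij)}(xw)=x\,a_{(ij)}(w)\ \text{ for } x\notin\{i,j\};$$ the same formulas describe its action on infinite words (so $a_{(ij)}$ changes the first letter belonging to $\{i,j\}$ to the other element of $\{i,j\}$, if there is such a letter). The Hanoi Towers group on $k$ pegs is $H^{(k)}=\langle S\rangle$ with $S=\{a_{(ij)}\mid 0\le i<j\le k-1\}$. For $\xi\in\partial\mathcal{T}$, the Schreier graph $\Gamma_\xi=\Gamma(H^{(k)},P_\xi,S)$, where $P_\xi$ is the stabilizer of $\xi$ in $H^{(k)}$,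 is the graph of the action of $H^{(k)}$ on the orbit of $\xi$: its vertices are the points of the orbit of $\xi$ and each vertex $v$ is joined to $s(v)$ for each $s\in S$. Here $\xi=000\dots$. Asymptotic convention: $f\preceq g$ means that there exists $C>0$ such that $f(n)\le g(Cn)$ for all $n\ge 0$; when one of the functions involves $\log n$, only $n\ge1$ is considered. The growth of $\Gamma_\xi$ is called intermediate if $\lim_{n\to\infty}\sqrt[n]{\gamma(n)}=1$ and $n^m\preceq\gamma(n)$ for all $m>0$. *)

theory Defs
  imports Complex_Main "HOL-Algebra.Bij" "HOL-Algebra.Generated_Groups"
begin

text \<open>The words over \<open>{0, ..., k - 1}\<close> are the elements of \<^term>\<open>lists {..<k}\<close>; the children of
  \<open>u\<close> are the words \<open>u @ [x]\<close>.  As in \<^const>\<open>BijGroup\<close>, automorphisms are taken to be \<open>undefined\<close>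
  outside the set of words.\<close>

definition tree_aut :: "nat \<Rightarrow> (nat list \<Rightarrow> nat list) set" where
  "tree_aut k = {g \<in> Bij (lists {..<k}).
     g [] = [] \<and> (\<forall>u\<in>lists {..<k}. \<forall>x<k. \<exists>y<k. g (u @ [x]) = g u @ [y])}"

definition tree_aut_group :: "nat \<Rightarrow> (nat list \<Rightarrow> nat list) monoid" where
  "tree_aut_group k = (BijGroup (lists {..<k})) \<lparr>carrier := tree_aut k\<rparr>"

definition boundary :: "nat \<Rightarrow> (nat \<Rightarrow> nat) set" where
  "boundary k = {\<xi>. \<forall>n. \<xi> n < k}"

text \<open>The prefix of length \<open>n\<close> of \<open>g \<xi>\<close> is the image under \<open>g\<close> of the prefix of length \<open>n\<close> of \<open>\<xi>\<close>.\<close>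

definition boundary_act :: "(nat list \<Rightarrow> nat list) \<Rightarrow> (nat \<Rightarrow> nat) \<Rightarrow> (nat \<Rightarrow> nat)" where
  "boundary_act g \<xi> = (\<lambda>n. g (map \<xi> [0..<Suc n]) ! n)"

fun hanoi_map :: "nat \<Rightarrow> nat \<Rightarrow> nat list \<Rightarrow> nat list" where
  "hanoi_map i j [] = []"
| "hanoi_map i j (x # w) =
     (if x = i then j # w else if x = j then i # w else x # hanoi_map i j w)"

definition hanoi_gens :: "nat \<Rightarrow> (nat list \<Rightarrow> nat list) set" where
  "hanoi_gens k = {restrict (hanoi_map i j) (lists {..<k}) | i j. i < j \<and> j < k}"

definition hanoi_group :: "nat \<Rightarrow> (nat list \<Rightarrow> nat list) set" where
  "hanoi_group k = generate (tree_aut_group k) (hanoi_gens k)"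

definition orbit :: "(nat list \<Rightarrow> nat list) set \<Rightarrow> (nat \<Rightarrow> nat) \<Rightarrow> (nat \<Rightarrow> nat) set" where
  "orbit G \<xi> = (\<lambda>g. boundary_act g \<xi>) ` G"

definition schreier_edges ::
    "(nat list \<Rightarrow> nat list) set \<Rightarrow> (nat list \<Rightarrow> nat list) set \<Rightarrow> (nat \<Rightarrow> nat) \<Rightarrow> ((nat \<Rightarrow> nat) \<times> (nat \<Rightarrow> nat)) set" where
  "schreier_edges G S \<xi> = {(v, boundary_act s v) | v s. v \<in> orbit G \<xi> \<and> s \<in> S}"

text \<open>The ball of real radius \<open>r\<close> around \<open>\<xi>\<close>: distances are those of the underlying undirected graph.\<close>

definition schreier_ball ::
    "(nat list \<Rightarrow> nat list) set \<Rightarrow> (nat list \<Rightarrow> nat list) set \<Rightarrow> (nat \<Rightarrow> nat) \<Rightarrow> real \<Rightarrow> (nat \<Rightarrow> nat) set" where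
  "schreier_ball G S \<xi> r = {v \<in> orbit G \<xi>. \<exists>m. real m \<le> r \<and>
     (\<xi>, v) \<in> (schreier_edges G S \<xi> \<union> (schreier_edges G S \<xi>)\<inverse>) ^^ m}"

definition schreier_growth ::
    "(nat list \<Rightarrow> nat list) set \<Rightarrow> (nat list \<Rightarrow> nat list) set \<Rightarrow> (nat \<Rightarrow> nat) \<Rightarrow> real \<Rightarrow> real" where
  "schreier_growth G S \<xi> r = real (card (schreier_ball G S \<xi> r))"

definition hanoi_growth :: "nat \<Rightarrow> real \<Rightarrow> real" where
  "hanoi_growth k = schreier_growth (hanoi_group k) (hanoi_gens k) (\<lambda>_. 0)"

text \<open>The argument \<open>n0\<close> is the least natural number at which the functions are compared.  Only
  natural \<open>n\<close> are considered, but the constant \<open>C\<close> may be any positive real.\<close>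

definition growth_le :: "nat \<Rightarrow> (real \<Rightarrow> real) \<Rightarrow> (real \<Rightarrow> real) \<Rightarrow> bool" where
  "growth_le n0 f g \<longleftrightarrow> (\<exists>C>0. \<forall>n\<ge>n0. f (real n) \<le> g (C * real n))"

definition intermediate_growth :: "(real \<Rightarrow> real) \<Rightarrow> bool" where
  "intermediate_growth \<gamma> \<longleftrightarrow>
     (\<lambda>n. root n (\<gamma> (real n))) \<longlonglongrightarrow> 1 \<and> (\<forall>m::real. m > 0 \<longrightarrow> growth_le 0 (\<lambda>x. x powr m) \<gamma>)"

lemma tree_aut_length:
  assumes g: "g \<in> tree_aut k" and w: "w \<in> lists {..<k}"
  shows "length (g w) = length w"
  using w
proof (induction w rule: rev_induct)
  case Nil
  then show ?case using g by (simp add: tree_aut_def)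
next
  case (snoc x u)
  then obtain y where "g (u @ [x]) = g u @ [y]"
    using g snoc.prems unfolding tree_aut_def by fastforce
  then show ?case using snoc by simp
qed

lemma subgroup_tree_aut: "subgroup (tree_aut k) (BijGroup (lists {..<k}))"
proof -
  let ?W = "lists {..<k}"
  interpret B: group "BijGroup ?W" by (rule group_BijGroup)
  have bij: "bij_betw g ?W ?W" if "g \<in> tree_aut k" for g
    using that by (simp add: tree_aut_def Bij_def)
  show ?thesis
  proof (rule B.subgroupI)
    show "tree_aut k \<subseteq> carrier (BijGroup ?W)"
      by (auto simp: tree_aut_def BijGroup_def)
    have "restrict id ?W \<in> tree_aut k"
      using id_Bij[of ?W] by (auto simp: tree_aut_def id_def)
    then show "tree_aut k \<noteq> {}" by blast
  next
    fix g assume g: "g \<in> tree_aut k"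
    let ?h = "restrict (inv_into ?W g) ?W"
    have gB: "g \<in> Bij ?W" using g by (simp add: tree_aut_def)
    have inv: "inv\<^bsub>BijGroup ?W\<^esub> g = ?h" using gB by (rule inv_BijGroup)
    have hB: "?h \<in> Bij ?W" using gB by (rule restrict_inv_into_Bij)
    have gh: "g (?h v) = v" "?h v \<in> ?W" if "v \<in> ?W" for v
      using that bij[OF g]
      by (auto simp: bij_betw_def f_inv_into_f inv_into_into simp del: in_lists_conv_set)
    have hg: "?h (g v) = v" if "v \<in> ?W" for v
      using that bij[OF g] by (auto simp: bij_betw_def simp del: in_lists_conv_set)
    have "?h [] = []" using hg[of "[]"] g by (simp add: tree_aut_def)
    moreover have "\<exists>y<k. ?h (u @ [x]) = ?h u @ [y]" if u: "u \<in> ?W" and x: "x < k" for u x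
    proof -
      have ux: "u @ [x] \<in> ?W" using u x by auto
      let ?v = "?h (u @ [x])"
      have v: "?v \<in> ?W" "g ?v = u @ [x]" using gh[OF ux] by auto
      have "length ?v = Suc (length u)"
        using tree_aut_length[OF g v(1)] v(2) by simp
      then obtain v' y where vy: "?v = v' @ [y]" by (cases ?v rule: rev_cases) auto
      then have v': "v' \<in> ?W" "y < k" using v(1) by (auto simp del: restrict_apply)
      then obtain z where "g (v' @ [y]) = g v' @ [z]"
        using g v' unfolding tree_aut_def by blast
      then have "g v' = u" using v(2) vy by simp
      then have "?h u = v'" using hg[OF v'(1)] by simp
      then show ?thesis using vy v'(2) by metis
    qed
    ultimately show "inv\<^bsub>BijGroup ?W\<^esub> g \<in> tree_aut k"
      unfolding inv tree_aut_def using hB by blast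
  next
    fix g h assume g: "g \<in> tree_aut k" and h: "h \<in> tree_aut k"
    have gB: "g \<in> Bij ?W" "h \<in> Bij ?W" using g h by (auto simp: tree_aut_def)
    have mult: "g \<otimes>\<^bsub>BijGroup ?W\<^esub> h = compose ?W g h" using gB by (simp add: BijGroup_def)
    have "compose ?W g h [] = []" using g h by (simp add: tree_aut_def compose_def)
    moreover have "\<exists>y<k. compose ?W g h (u @ [x]) = compose ?W g h u @ [y]"
      if u: "u \<in> ?W" and x: "x < k" for u x
    proof -
      have ux: "u @ [x] \<in> ?W" using u x by auto
      obtain y where y: "y < k" "h (u @ [x]) = h u @ [y]"
        using h u x unfolding tree_aut_def by blast
      have "h u \<in> ?W" using bij[OF h] u by (meson bij_betwE)
      then obtain z where "z < k" "g (h u @ [y]) = g (h u) @ [z]"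
        using g y unfolding tree_aut_def by blast
      then show ?thesis using y u ux by (metis compose_eq)
    qed
    ultimately show "g \<otimes>\<^bsub>BijGroup ?W\<^esub> h \<in> tree_aut k"
      unfolding mult tree_aut_def using compose_Bij[OF gB] by blast
  qed
qed

lemma group_tree_aut_group: "group (tree_aut_group k)"
  unfolding tree_aut_group_def
  by (rule subgroup.subgroup_is_group[OF subgroup_tree_aut group_BijGroup])

lemma hanoi_map_involution: "hanoi_map i j (hanoi_map i j w) = w"
  by (induction i j w rule: hanoi_map.induct) auto

lemma hanoi_map_lists:
  "i < k \<Longrightarrow> j < k \<Longrightarrow> w \<in> lists {..<k} \<Longrightarrow> hanoi_map i j w \<in> lists {..<k}"
  by (induction i j w rule: hanoi_map.induct) auto

lemma hanoi_map_snoc: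
  "i < k \<Longrightarrow> j < k \<Longrightarrow> x < k \<Longrightarrow> \<exists>y<k. hanoi_map i j (u @ [x]) = hanoi_map i j u @ [y]"
  by (induction u) auto

lemma hanoi_gens_subset: "hanoi_gens k \<subseteq> carrier (tree_aut_group k)"
proof
  fix g assume "g \<in> hanoi_gens k"
  then obtain i j where ij: "i < k" "j < k" and g: "g = restrict (hanoi_map i j) (lists {..<k})"
    unfolding hanoi_gens_def using less_trans by blast
  have "bij_betw (hanoi_map i j) (lists {..<k}) (lists {..<k})"
    by (rule bij_betw_byWitness[where f' = "hanoi_map i j"])
      (use hanoi_map_lists[OF ij] in \<open>auto simp: hanoi_map_involution simp del: in_lists_conv_set\<close>)
  then have "g \<in> Bij (lists {..<k})"
    by (simp add: g Bij_def bij_betw_restrict_eq)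
  moreover have "\<exists>y<k. g (u @ [x]) = g u @ [y]" if "u \<in> lists {..<k}" "x < k" for u x
    using hanoi_map_snoc[OF ij that(2), of u] that by (auto simp: g)
  ultimately show "g \<in> carrier (tree_aut_group k)"
    by (auto simp: tree_aut_group_def tree_aut_def g)
qed

lemma boundary_act_in_boundary:
  assumes g: "g \<in> tree_aut k" and "\<xi> \<in> boundary k"
  shows "boundary_act g \<xi> \<in> boundary k"
proof -
  have "boundary_act g \<xi> n < k" for n
  proof -
    have w: "map \<xi> [0..<Suc n] \<in> lists {..<k}" using assms(2) by (auto simp: boundary_def)
    then have "g (map \<xi> [0..<Suc n]) \<in> lists {..<k}"
      using g unfolding tree_aut_def Bij_def by (auto dest: bij_betwE simp del: upt_Suc)
    moreover have "n < length (g (map \<xi> [0..<Suc n]))" using tree_aut_length[OF g w] by simp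
    ultimately show ?thesis unfolding boundary_act_def
      by (metis in_listsD lessThan_iff nth_mem)
  qed
  then show ?thesis by (simp add: boundary_def)
qed

text \<open>The recursion for the generators on infinite words; \<^term>\<open>case_nat x w\<close> is the infinite word
  with first letter \<open>x\<close> and remainder \<open>w\<close>.\<close>

lemma boundary_act_hanoi_gen:
  assumes x: "x < k" and w: "w \<in> boundary k"
  defines "a \<equiv> (\<lambda>i j. restrict (hanoi_map i j) (lists {..<k}))"
  shows "boundary_act (a i j) (case_nat x w) =
    (if x = i then case_nat j w else if x = j then case_nat i w
     else case_nat x (boundary_act (a i j) w))"
proof
  fix n
  have map: "map (case_nat x w) [0..<Suc n] = x # map w [0..<n]"
    by (simp add: map_upt_Suc del: upt_Suc)
  have "x # map w [0..<n] \<in> lists {..<k}" "map w [0..<n] \<in> lists {..<k}"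
    using x w by (auto simp: boundary_def)
  then show "boundary_act (a i j) (case_nat x w) n =
      (if x = i then case_nat j w else if x = j then case_nat i w
       else case_nat x (boundary_act (a i j) w)) n"
    unfolding boundary_act_def map a_def
    by (cases n) (auto simp del: upt_Suc)
qed

end

theory Submission
  imports Defs
begin

text \<open>An infinite word is a configuration of the Towers of Hanoi game on \<open>k\<close> pegs with infinitely many
  disks: the letter at position \<open>n\<close> is the peg that holds disk \<open>n\<close>, and smaller positions are smaller
  disks.  The generator exchanging \<open>i\<close> and \<open>j\<close> moves the smallest disk on the pegs \<open>i\<close> and \<open>j\<close> from one of them
  to the other, so the edges of the Schreier graph, apart from loops, are the legal moves, and the ball of
  radius \<open>r\<close> consists of the configurations that are reached from \<open>000...\<close> by at most \<open>r\<close> moves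
  (lemma \<open>schreier_ball_eq\<close>).  The theorem amounts to the fact that \<open>exp (c * n powr (1 / (k - 2)))\<close>
  moves are needed to displace disk \<open>n\<close>, and that as many, with another constant \<open>c\<close>, suffice
  to reach every configuration of the first \<open>n\<close> disks.  Let \<open>k = d + 2\<close>.

  Lower bound for the number of moves (an argument of Szegedy).  A sequence of moves, from any
  configuration, that moves each of \<open>2 ^ (d + 1) * (s + 1) ^ d\<close> disks has length at least \<open>2 ^ s\<close> (lemma
  \<open>many_moves\<close>); this is shown by induction on \<open>d\<close> and \<open>s\<close>, the case of two pegs being trivial.
  When disk \<open>n\<close> first leaves peg \<open>0\<close>, all smaller disks have left it already, so the bound applies to the
  disks \<open>0, ..., n\<close>.  Hence in the ball of radius \<open>r < 2 ^ s\<close> only the first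
  \<open>2 ^ (d + 1) * (s + 1) ^ d\<close> letters can be nonzero, and with \<open>s\<close> about \<open>log 2 r\<close> this bounds the growth from above.

  Upper bound for the number of moves (Frame and Stewart).  Up to \<open>s choose d\<close> disks can be gathered on any
  peg, from any configuration, by at most \<open>5 ^ s\<close> moves (lemma \<open>gather\<close>).  As moves are
  reversible, the ball of radius \<open>5 ^ s\<close> contains \<open>k ^ (s choose d)\<close> words, and
  \<open>s choose d \<ge> (s / d) ^ d\<close> gives the lower bound for the growth.

  Finally \<open>(log n) ^ d = o(n)\<close> shows that the growth is subexponential, and \<open>d \<ge> 2\<close> that it exceeds every
  polynomial.\<close>

section \<open>Towers of Hanoi with arbitrary sets of pegs and disks\<close>

text \<open>A configuration \<open>c\<close> puts disk \<open>n\<close> on peg \<open>c n\<close>; smaller numbers are smaller disks.  A move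
  \<open>(n, q)\<close> takes disk \<open>n\<close> to peg \<open>q\<close>.  In \<open>legal P D c ms\<close> the moves \<open>ms\<close> can be made one after the other
  from \<open>c\<close> in the game with pegs \<open>P\<close> and disks \<open>D\<close>; disks outside \<open>D\<close> are ignored.  Every move
  changes the position of its disk.\<close>

fun legal :: "nat set \<Rightarrow> nat set \<Rightarrow> (nat \<Rightarrow> nat) \<Rightarrow> (nat \<times> nat) list \<Rightarrow> bool" where
  "legal P D c [] = True"
| "legal P D c ((n, q) # ms) =
     (n \<in> D \<and> c n \<in> P \<and> q \<in> P \<and> q \<noteq> c n \<and> (\<forall>m\<in>D. m < n \<longrightarrow> c m \<noteq> c n \<and> c m \<noteq> q) \<and>
      legal P D (c(n := q)) ms)"

text \<open>The configuration after the moves.\<close>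

fun final :: "(nat \<Rightarrow> nat) \<Rightarrow> (nat \<times> nat) list \<Rightarrow> (nat \<Rightarrow> nat)" where
  "final c [] = c"
| "final c ((n, q) # ms) = final (c(n := q)) ms"

text \<open>Configurations in induction hypotheses are eta-expanded, so that simplification turns an update into a
  conditional; this rule turns it back.\<close>

lemma fold_fun_upd [simp]: "(\<lambda>m. if m = n then q else c m) = c(n := q)"
  by auto

lemma moves_induct [case_names Nil Cons]:
  fixes R :: "(nat \<Rightarrow> nat) \<Rightarrow> (nat \<times> nat) list \<Rightarrow> bool"
  assumes "\<And>c. R c []" "\<And>c n q ms. R (c(n := q)) ms \<Longrightarrow> R c ((n, q) # ms)"
  shows "R c ms"
  using assms by (induction ms arbitrary: c) auto

lemma final_append: "final c (ms @ ms') = final (final c ms) ms'"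
  by (induction c ms rule: moves_induct) auto

lemma legal_append: "legal P D c (ms @ ms') \<longleftrightarrow> legal P D c ms \<and> legal P D (final c ms) ms'"
  by (induction c ms rule: moves_induct) auto

lemma final_unmoved: "n \<notin> fst ` set ms \<Longrightarrow> final c ms n = c n"
  by (induction c ms rule: moves_induct) auto

lemma legal_moved_subset: "legal P D c ms \<Longrightarrow> fst ` set ms \<subseteq> D"
  by (induction c ms rule: moves_induct) auto

lemma final_pegs: "legal P D c ms \<Longrightarrow> c ` D \<subseteq> P \<Longrightarrow> final c ms ` D \<subseteq> P"
proof (induction c ms rule: moves_induct)
  case (Cons c n q ms)
  have "(c(n := q)) ` D \<subseteq> P" using Cons by auto
  with Cons show ?case by simp
qed simp

lemma legal_reverse:
  assumes "legal P D c ms"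
  obtains ms' where "legal P D (final c ms) ms'" "length ms' = length ms"
    "final (final c ms) ms' = c"
proof -
  have "\<exists>ms'. legal P D (final c ms) ms' \<and> length ms' = length ms \<and> final (final c ms) ms' = c"
    using assms
  proof (induction c ms rule: moves_induct)
    case (Cons c n q ms)
    then obtain ms' where ms': "legal P D (final (c(n := q)) ms) ms'" "length ms' = length ms"
      "final (final (c(n := q)) ms) ms' = c(n := q)" by auto
    have "legal P D (final (c(n := q)) ms) (ms' @ [(n, c n)])"
      using ms' Cons by (auto simp: legal_append)
    moreover have "final (final (c(n := q)) ms) (ms' @ [(n, c n)]) = c"
      using ms' by (simp add: final_append)
    ultimately show ?case using ms' by (intro exI[of _ "ms' @ [(n, c n)]"]) simp
  qed simp
  then show ?thesis using that by blast
qed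

text \<open>Forgetting disks keeps a sequence of moves legal.\<close>

lemma legal_filter:
  "\<lbrakk>legal P D c ms; E \<subseteq> D; \<forall>n\<in>E. c' n = c n\<rbrakk> \<Longrightarrow> legal P E c' (filter (\<lambda>x. fst x \<in> E) ms)"
proof (induction c ms arbitrary: c' rule: moves_induct)
  case (Cons c n q ms)
  show ?case
  proof (cases "n \<in> E")
    case True
    have "legal P E (c'(n := q)) (filter (\<lambda>x. fst x \<in> E) ms)"
      using Cons by (intro Cons.IH) auto
    moreover have "\<forall>m\<in>E. m < n \<longrightarrow> c' m \<noteq> c' n \<and> c' m \<noteq> q"
      using Cons.prems True by (metis legal.simps(2) subset_iff)
    ultimately show ?thesis using Cons True by auto
  next
    case False
    have "legal P E c' (filter (\<lambda>x. fst x \<in> E) ms)"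
      using Cons False by (intro Cons.IH) auto
    then show ?thesis using False by simp
  qed
qed simp

text \<open>A disk \<open>j\<close> that stays at rest blocks its peg for all larger disks.\<close>

lemma moved_not_blocked:
  "\<lbrakk>legal P D c ms; j \<in> D; j \<notin> fst ` set ms; j < e; e \<in> fst ` set ms\<rbrakk> \<Longrightarrow> c e \<noteq> c j"
proof (induction c ms rule: moves_induct)
  case (Cons c n q ms)
  show ?case
  proof (cases "n = e")
    case True
    then show ?thesis using Cons by fastforce
  next
    case False
    then have "(c(n := q)) e \<noteq> (c(n := q)) j"
      using Cons by (intro Cons.IH) (auto simp del: fun_upd_apply)
    then show ?thesis using False Cons by (auto split: if_splits)
  qed
qed simp

lemma legal_blocked_peg:
  "\<lbrakk>legal P D c ms; j \<in> D; j \<notin> fst ` set ms; E \<subseteq> D; \<forall>e\<in>E. j < e; \<forall>n\<in>E. c' n = c n\<rbrakk>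
    \<Longrightarrow> legal (P - {c j}) E c' (filter (\<lambda>x. fst x \<in> E) ms)"
proof (induction c ms arbitrary: c' rule: moves_induct)
  case (Cons c n q ms)
  have nj: "n \<noteq> j" using Cons by auto
  show ?case
  proof (cases "n \<in> E")
    case True
    have "legal (P - {(c(n := q)) j}) E (c'(n := q)) (filter (\<lambda>x. fst x \<in> E) ms)"
    proof (rule Cons.IH)
      show "\<forall>x\<in>E. (c'(n := q)) x = (c(n := q)) x" using Cons by simp
    qed (use Cons in auto)
    moreover have "\<forall>m\<in>E. m < n \<longrightarrow> c' m \<noteq> c' n \<and> c' m \<noteq> q"
      using Cons.prems True by (metis legal.simps(2) subset_iff)
    moreover have "c n \<noteq> c j" "q \<noteq> c j"
      using Cons.prems True by fastforce+
    ultimately show ?thesis using Cons True nj by auto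
  next
    case False
    have "legal (P - {(c(n := q)) j}) E c' (filter (\<lambda>x. fst x \<in> E) ms)"
    proof (rule Cons.IH)
      show "\<forall>x\<in>E. c' x = (c(n := q)) x" using Cons False by auto
    qed (use Cons in auto)
    then show ?thesis using False nj by simp
  qed
qed simp

text \<open>Conversely, disks resting on a peg that is not used do not hinder the others, and larger disks
  never matter.\<close>

lemma legal_parked:
  "\<lbrakk>legal (P - {p}) L c ms; \<forall>x\<in>S. c x = p\<rbrakk> \<Longrightarrow> legal P (S \<union> L) c ms"
proof (induction c ms rule: moves_induct)
  case (Cons c n q ms)
  have "n \<notin> S" using Cons by auto
  then have "\<forall>x\<in>S. (c(n := q)) x = p" using Cons by auto
  then have "legal P (S \<union> L) (c(n := q)) ms" using Cons by auto
  then show ?case using Cons by auto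
qed simp

lemma legal_add_larger:
  "\<lbrakk>legal P D c ms; D \<subseteq> D'; \<forall>x\<in>D. \<forall>y\<in>D' - D. x < y\<rbrakk> \<Longrightarrow> legal P D' c ms"
proof (induction c ms rule: moves_induct)
  case (Cons c n q ms)
  have "m \<in> D" if "m \<in> D'" "m < n" for m using Cons that
    by (metis DiffI legal.simps(2) order.asym)
  then show ?case using Cons by auto
qed simp

lemma split_small_large:
  fixes D :: "nat set"
  assumes "finite D" "b \<le> card D"
  obtains S L where "D = S \<union> L" "S \<inter> L = {}" "card S = card D - b" "card L = b"
    "\<forall>x\<in>S. \<forall>y\<in>L. x < y"
proof -
  have "\<exists>S L. D = S \<union> L \<and> S \<inter> L = {} \<and> card L = b \<and> (\<forall>x\<in>S. \<forall>y\<in>L. x < y)"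
    using assms
  proof (induction b)
    case 0
    show ?case by (intro exI[of _ D] exI[of _ "{}"]) simp
  next
    case (Suc b)
    then obtain S L where SL: "D = S \<union> L" "S \<inter> L = {}" "card L = b" "\<forall>x\<in>S. \<forall>y\<in>L. x < y"
      by auto
    have fin: "finite S" "finite L" using SL(1) Suc.prems(1) by auto
    have ne: "S \<noteq> {}" using SL Suc.prems by auto
    let ?m = "Max S"
    have m: "?m \<in> S" using fin ne by simp
    have small: "x < ?m" if "x \<in> S - {?m}" for x
      using that fin by (metis Diff_iff Max_ge insertI1 le_neq_implies_less)
    show ?case
    proof (intro exI conjI)
      show "D = (S - {?m}) \<union> insert ?m L" "(S - {?m}) \<inter> insert ?m L = {}" using SL m by blast+
      show "card (insert ?m L) = Suc b" using SL(2,3) m fin by (subst card_insert_disjoint) auto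
      show "\<forall>x\<in>S - {?m}. \<forall>y\<in>insert ?m L. x < y" using SL(4) small by blast
    qed
  qed
  then obtain S L where SL: "D = S \<union> L" "S \<inter> L = {}" "card L = b" "\<forall>x\<in>S. \<forall>y\<in>L. x < y"
    by auto
  have "card S = card D - b" using SL assms(1) by (simp add: card_Un_disjoint)
  then show ?thesis using SL that by blast
qed


section \<open>Moving every disk takes many moves\<close>

lemma shortest_prefix_moving_all:
  assumes "S \<subseteq> fst ` set ms" "S \<noteq> {}"
  obtains A x B where "ms = A @ x # B" "\<not> S \<subseteq> fst ` set A" "S \<subseteq> fst ` set (A @ [x])"
proof -
  have "\<exists>A x B. ms = A @ x # B \<and> \<not> S \<subseteq> fst ` set A \<and> S \<subseteq> fst ` set (A @ [x])"
    using assms(1)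
  proof (induction ms rule: rev_induct)
    case Nil
    then show ?case using assms(2) by simp
  next
    case (snoc x ms)
    show ?case
    proof (cases "S \<subseteq> fst ` set ms")
      case True
      then obtain A y B where "ms = A @ y # B" "\<not> S \<subseteq> fst ` set A" "S \<subseteq> fst ` set (A @ [y])"
        using snoc.IH by blast
      then show ?thesis by (intro exI[of _ A] exI[of _ y] exI[of _ "B @ [x]"]) simp
    next
      case False
      then show ?thesis using snoc.prems
        by (intro exI[of _ ms] exI[of _ x] exI[of _ "[]"]) auto
    qed
  qed
  then show ?thesis using that by blast
qed

lemma two_pegs_larger_unmoved:
  "\<lbrakk>legal P D c ms; c ` D \<subseteq> P; card P = 2; a \<in> D; a < b\<rbrakk> \<Longrightarrow> b \<notin> fst ` set ms"
proof (induction c ms rule: moves_induct)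
  case (Cons c n q ms)
  have "(c(n := q)) ` D \<subseteq> P" using Cons by auto
  then have "b \<notin> fst ` set ms" using Cons by (intro Cons.IH) auto
  moreover have "b \<noteq> n"
  proof
    assume "b = n"
    then have "c a \<noteq> c n" "c a \<noteq> q" "q \<noteq> c n" "{c a, c n, q} \<subseteq> P" using Cons by auto
    moreover have "finite P" using Cons by (intro card_ge_0_finite) simp
    ultimately have "card {c a, c n, q} \<le> card P" by (intro card_mono) auto
    moreover have "card {c a, c n, q} = 3"
      using \<open>c a \<noteq> c n\<close> \<open>c a \<noteq> q\<close> \<open>q \<noteq> c n\<close> by auto
    ultimately show False using Cons by simp
  qed
  ultimately show ?case by auto
qed simp

text \<open>The smallest disks \<open>S\<close> are separated from the \<open>2 * m\<close> largest disks \<open>L\<close>, and the moves are cut at the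
  first moment when each disk of \<open>S\<close> has moved.  If every disk of \<open>S\<close> moves again afterwards, the number of moves
  is at least twice the bound for \<open>S\<close>.  Otherwise some disk of \<open>S\<close> rests before the cutting move \<open>x\<close>, some
  disk of \<open>S\<close> rests after it, and each of them makes a peg useless for \<open>L\<close>.  One of the two parts moves \<open>m\<close>
  disks of \<open>L\<close>, and the bound with one peg less applies to them.\<close>

lemma many_moves:
  assumes "finite D" "card P = d + 2" "2 ^ (d + 1) * (s + 1) ^ d \<le> card D"
    "legal P D c ms" "c ` D \<subseteq> P" "D \<subseteq> fst ` set ms"
  shows "2 ^ s \<le> length ms"
  using assms
proof (induction d arbitrary: s P D c ms)
  case 0
  then have "\<not> card D \<le> 1" by simp
  then obtain a b where "a \<in> D" "b \<in> D" "a \<noteq> b"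
    using \<open>finite D\<close> by (metis card_le_Suc0_iff_eq One_nat_def)
  then obtain a b where "a \<in> D" "b \<in> D" "a < b" by (metis nat_neq_iff)
  then show ?case using two_pegs_larger_unmoved 0 by fastforce
next
  case (Suc d)
  note fewer_pegs = Suc.IH
  show ?case using Suc.prems
  proof (induction s arbitrary: D c ms)
    case 0
    then have "D \<noteq> {}" by auto
    then show ?case using 0 by (cases ms) auto
  next
    case (Suc s)
    \<comment> \<open>the number of disks for which the bound with one peg less gives \<open>2 ^ Suc s\<close>\<close>
    define m where "m = (2::nat) ^ (d + 1) * (s + 2) ^ d"
    have D_large: "2 * m * (s + 2) \<le> card D"
      using Suc.prems(3) unfolding m_def by (simp add: algebra_simps)
    have "2 * m \<le> 2 * m * (s + 2)" by simp
    then have "2 * m \<le> card D" using D_large by linarith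
    then obtain S L where SL: "D = S \<union> L" "S \<inter> L = {}" "card S = card D - 2 * m"
        "card L = 2 * m" "\<forall>x\<in>S. \<forall>y\<in>L. x < y"
      using split_small_large \<open>finite D\<close> by metis
    have fin: "finite S" "finite L" using SL(1) \<open>finite D\<close> by auto
    have "2 ^ (Suc d + 1) * (s + 1) ^ Suc d \<le> 2 * m * (s + 1)"
      unfolding m_def
      by (simp add: algebra_simps add_mono mult_mono power_mono)
    also have "\<dots> \<le> card S" using D_large SL(3) by (simp add: algebra_simps)
    finally have S_large: "2 ^ (Suc d + 1) * (s + 1) ^ Suc d \<le> card S" .
    then have "S \<noteq> {}" by auto
    moreover have "S \<subseteq> fst ` set ms" using Suc.prems SL by auto
    ultimately obtain A x B where ms: "ms = A @ x # B" and A: "\<not> S \<subseteq> fst ` set A"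
      and Ax: "S \<subseteq> fst ` set (A @ [x])"
      using shortest_prefix_moving_all by metis
    define c1 where "c1 = final c (A @ [x])"
    have "legal P D c ((A @ [x]) @ B)" using Suc.prems ms by simp
    then have legal_parts: "legal P D c (A @ [x])" "legal P D c1 B"
      unfolding legal_append[of P D c "A @ [x]"] c1_def by blast+
    have c1: "c1 ` D \<subseteq> P" unfolding c1_def using final_pegs legal_parts(1) Suc.prems by blast
    have all_small: "2 ^ s \<le> length M"
      if "legal P D c' M" "c' ` D \<subseteq> P" "S \<subseteq> fst ` set M" for c' M
    proof -
      let ?M = "filter (\<lambda>x. fst x \<in> S) M"
      have "legal P S c' ?M" using that SL by (intro legal_filter[where D = D]) auto
      moreover have "S \<subseteq> fst ` set ?M" using that by auto
      ultimately have "2 ^ s \<le> length ?M" using Suc.prems that SL fin S_large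
        by (intro Suc.IH[of S c' ?M]) auto
      then show ?thesis using length_filter_le[of "\<lambda>x. fst x \<in> S" M] by linarith
    qed
    have half_large: "2 ^ Suc s \<le> length M"
      if M: "legal P D c' M" "c' ` D \<subseteq> P" and j: "j \<in> S" "j \<notin> fst ` set M"
        and E: "E \<subseteq> L" "E \<subseteq> fst ` set M" "m \<le> card E" for c' M j E
    proof -
      let ?M = "filter (\<lambda>x. fst x \<in> E) M"
      have jE: "\<forall>e\<in>E. j < e" using SL j E by auto
      have "legal (P - {c' j}) E c' ?M"
        using M j E SL jE by (intro legal_blocked_peg[where D = D]) auto
      moreover have "c' ` E \<subseteq> P - {c' j}"
      proof -
        have "c' e \<noteq> c' j" if "e \<in> E" for e
          using moved_not_blocked[OF M(1) _ j(2)] that jE E(2) j(1) SL(1) by blast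
        then show ?thesis using M(2) E SL by auto
      qed
      moreover have "card (P - {c' j}) = d + 2"
        using M(2) j SL \<open>card P = Suc d + 2\<close> by (subst card_Diff_singleton) auto
      moreover have "E \<subseteq> fst ` set ?M" using E by auto
      moreover have "finite E" using E fin finite_subset by blast
      ultimately have "2 ^ Suc s \<le> length ?M" using E(3)
        by (intro fewer_pegs[of E "P - {c' j}" "Suc s" c' ?M]) (auto simp: m_def)
      then show ?thesis using length_filter_le[of "\<lambda>x. fst x \<in> E" M] by linarith
    qed
    show ?case
    proof (cases "S \<subseteq> fst ` set B")
      case True
      have "2 ^ s \<le> length (A @ [x])" using all_small[OF legal_parts(1) _ Ax] Suc.prems by blast
      moreover have "2 ^ s \<le> length B" using all_small[OF legal_parts(2) c1 True] .
      ultimately show ?thesis using ms by simp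
    next
      case False
      then obtain j' where j': "j' \<in> S" "j' \<notin> fst ` set B" by blast
      obtain j where j: "j \<in> S" "j \<notin> fst ` set A" using A by blast
      have "fst x = j" using j Ax by auto
      then have "fst x \<notin> L" using j SL by auto
      then have "L \<subseteq> (L \<inter> fst ` set A) \<union> (L \<inter> fst ` set B)"
        using Suc.prems ms SL by auto
      then have "card L \<le> card ((L \<inter> fst ` set A) \<union> (L \<inter> fst ` set B))"
        by (intro card_mono) auto
      also have "\<dots> \<le> card (L \<inter> fst ` set A) + card (L \<inter> fst ` set B)"
        by (rule card_Un_le)
      finally consider "m \<le> card (L \<inter> fst ` set A)" | "m \<le> card (L \<inter> fst ` set B)"
        using SL(4) by linarith
      then show ?thesis
      proof cases
        case 1
        have "legal P D c A" using legal_parts(1) by (simp add: legal_append)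
        then have "2 ^ Suc s \<le> length A"
          using half_large[of c A j "L \<inter> fst ` set A"] 1 j Suc.prems by blast
        then show ?thesis using ms by simp
      next
        case 2
        then have "2 ^ Suc s \<le> length B"
          using half_large[of c1 B j' "L \<inter> fst ` set B"] legal_parts(2) c1 j' by blast
        then show ?thesis using ms by simp
      qed
    qed
  qed
qed

text \<open>When disk \<open>n\<close> leaves the initial peg for the first time, all smaller disks have left it.\<close>

lemma smaller_disks_moved:
  assumes "legal P UNIV (\<lambda>_. p) ms" "final (\<lambda>_. p) ms n \<noteq> p"
  shows "{..n} \<subseteq> fst ` set ms"
proof -
  have "{n} \<subseteq> fst ` set ms" using final_unmoved assms(2) by blast
  then obtain A x B where ms: "ms = A @ x # B" and "\<not> {n} \<subseteq> fst ` set A"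
      and "{n} \<subseteq> fst ` set (A @ [x])"
    by (rule shortest_prefix_moving_all) simp
  then have A: "n \<notin> fst ` set A" and x: "fst x = n" by auto
  obtain q where q: "x = (n, q)" using x by (cases x) auto
  have "final (\<lambda>_. p) A n = p" using A by (simp add: final_unmoved)
  then have "final (\<lambda>_. p) A m \<noteq> p" if "m < n" for m
    using assms(1) that unfolding ms legal_append q by auto
  then have "m \<in> fst ` set A" if "m < n" for m
    using final_unmoved that by metis
  then have "m \<in> fst ` set ms" if "m \<le> n" for m
    using that ms x by (cases "m = n") (auto simp: image_Un)
  then show ?thesis by blast
qed

lemma moves_reaching_disk:
  assumes "card P = d + 2" "p \<in> P" "legal P UNIV (\<lambda>_. p) ms" "final (\<lambda>_. p) ms n \<noteq> p"
    "2 ^ (d + 1) * (s + 1) ^ d \<le> Suc n"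
  shows "2 ^ s \<le> length ms"
proof -
  let ?M = "filter (\<lambda>x. fst x \<in> {..n}) ms"
  have "legal P {..n} (\<lambda>_. p) ?M" using assms by (intro legal_filter[where D = UNIV]) auto
  moreover have "{..n} \<subseteq> fst ` set ?M" using smaller_disks_moved[OF assms(3,4)] by auto
  ultimately have "2 ^ s \<le> length ?M" using assms by (intro many_moves[of "{..n}" P d s]) auto
  then show ?thesis using length_filter_le[of "\<lambda>x. fst x \<in> {..n}" ms] by linarith
qed


section \<open>Gathering all disks takes few moves\<close>

lemma gather_one:
  assumes "finite D" "card D \<le> 1" "c ` D \<subseteq> P" "p \<in> P"
  shows "\<exists>ms. legal P D c ms \<and> length ms \<le> 1 \<and> (\<forall>x\<in>D. final c ms x = p)"
proof (cases "\<forall>x\<in>D. c x = p")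
  case True
  then show ?thesis by (intro exI[of _ "[]"]) simp
next
  case False
  then obtain x where x: "x \<in> D" "c x \<noteq> p" by blast
  then have "D = {x}" using assms by (auto simp: card_le_Suc0_iff_eq)
  then show ?thesis using x assms by (intro exI[of _ "[(x, p)]"]) auto
qed

text \<open>The algorithm of Frame and Stewart, adapted to an arbitrary initial configuration.  The small disks \<open>S\<close>
  are parked on a peg \<open>q \<noteq> p\<close>, and the large disks \<open>L\<close> are moved to \<open>p\<close> without using that peg.  This leaves
  behind the large disks that lie on \<open>q\<close> from the beginning, so it is repeated with a third peg \<open>q'\<close>
  before \<open>S\<close> is brought to \<open>p\<close>.  These five stages multiply the number of moves by \<open>5\<close>, while the number of
  disks obeys Pascal's recursion.\<close>

lemma gather:
  assumes "finite D" "card P = d + 2" "card D \<le> s choose d" "c ` D \<subseteq> P" "p \<in> P"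
  shows "\<exists>ms. legal P D c ms \<and> length ms \<le> 5 ^ s \<and> (\<forall>x\<in>D. final c ms x = p)"
  using assms
proof (induction s arbitrary: d P D c p)
  case 0
  have "card D \<le> 1" using 0 by (cases d) auto
  then show ?case using gather_one[of D c P p] 0 by simp
next
  case (Suc s)
  show ?case
  proof (cases d)
    case 0
    then obtain ms where "legal P D c ms" "length ms \<le> 1" "\<forall>x\<in>D. final c ms x = p"
      using gather_one[of D c P p] Suc.prems by auto
    moreover have "(1::nat) \<le> 5 ^ Suc s" by simp
    ultimately show ?thesis by (meson order_trans)
  next
    case (Suc d')
    define b where "b = min (s choose d') (card D)"
    have "b \<le> card D" by (simp add: b_def)
    then obtain S L where SL: "D = S \<union> L" "S \<inter> L = {}" "card S = card D - b"
        "card L = b" "\<forall>x\<in>S. \<forall>y\<in>L. x < y"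
      using split_small_large \<open>finite D\<close> by metis
    have fin: "finite S" "finite L" using SL(1) \<open>finite D\<close> by auto
    have card_S: "card S \<le> s choose d" and card_L: "card L \<le> s choose d'"
      using SL Suc.prems(3) Suc unfolding b_def by auto
    have small: "\<exists>ms. legal P D c ms \<and> length ms \<le> 5 ^ s \<and> (\<forall>x\<in>S. final c ms x = r) \<and>
        (\<forall>x\<in>L. final c ms x = c x) \<and> final c ms ` D \<subseteq> P"
      if c: "c ` D \<subseteq> P" and r: "r \<in> P" for c r
    proof -
      obtain ms where ms: "legal P S c ms" "length ms \<le> 5 ^ s" "\<forall>x\<in>S. final c ms x = r"
        using Suc.IH[of S P d c r] c r card_S fin(1) SL(1) Suc.prems(2) by auto
      have "legal P D c ms" using legal_add_larger[OF ms(1)] SL by auto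
      moreover have "\<forall>x\<in>L. final c ms x = c x"
        using legal_moved_subset[OF ms(1)] SL(2) by (intro ballI final_unmoved) blast
      ultimately show ?thesis using ms final_pegs c by blast
    qed
    have large: "\<exists>ms. legal P D c ms \<and> length ms \<le> 5 ^ s \<and>
        (\<forall>x\<in>L. final c ms x = (if c x = r then r else p)) \<and> final c ms ` D \<subseteq> P"
      if c: "c ` D \<subseteq> P" and r: "r \<in> P" "r \<noteq> p" and S: "\<forall>x\<in>S. c x = r" for c r
    proof -
      define L' where "L' = {x \<in> L. c x \<noteq> r}"
      have L': "L' \<subseteq> L" "finite L'" "card L' \<le> s choose d'" "c ` L' \<subseteq> P - {r}"
        using card_L fin card_mono[of L L'] c SL unfolding L'_def by auto
      have "card (P - {r}) = d' + 2" using Suc.prems(2) Suc r by simp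
      then obtain ms where ms: "legal (P - {r}) L' c ms" "length ms \<le> 5 ^ s"
          "\<forall>x\<in>L'. final c ms x = p"
        using Suc.IH[of L' "P - {r}" d' c p] L' r Suc.prems(5) by auto
      have "legal P ((S \<union> (L - L')) \<union> L') c ms"
        using S by (intro legal_parked[OF ms(1)]) (auto simp: L'_def)
      moreover have "(S \<union> (L - L')) \<union> L' = D" using L' SL by auto
      ultimately have "legal P D c ms" by simp
      moreover have "final c ms x = (if c x = r then r else p)" if "x \<in> L" for x
      proof (cases "x \<in> L'")
        case True
        then show ?thesis using ms by (simp add: L'_def)
      next
        case False
        then have "final c ms x = c x"
          using legal_moved_subset[OF ms(1)] by (intro final_unmoved) blast
        then show ?thesis using False that by (simp add: L'_def)
      qed
      ultimately show ?thesis using ms final_pegs c by blast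
    qed
    have finP: "finite P" using Suc.prems(2) by (intro card_ge_0_finite) simp
    have "card (P - {p}) \<noteq> 0" using Suc.prems by simp
    then obtain q where q: "q \<in> P" "q \<noteq> p" by (metis DiffE card.empty equals0I insertI1)
    have "card (P - {p, q}) \<noteq> 0"
      using Suc.prems Suc q finP by (simp add: card_Diff_subset)
    then obtain q' where q': "q' \<in> P" "q' \<noteq> p" "q' \<noteq> q"
      by (metis DiffE card.empty equals0I insertI1 insertI2)
    \<comment> \<open>the five stages: \<open>S\<close> to \<open>q\<close>, large disks not on \<open>q\<close> to \<open>p\<close>, \<open>S\<close> to \<open>q'\<close>, all large disks to
      \<open>p\<close>, \<open>S\<close> to \<open>p\<close>\<close>
    obtain m1 where m1: "legal P D c m1" "length m1 \<le> 5 ^ s" "\<forall>x\<in>S. final c m1 x = q"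
        "final c m1 ` D \<subseteq> P"
      using small[OF Suc.prems(4) q(1)] by blast
    define c1 where "c1 = final c m1"
    obtain m2 where m2: "legal P D c1 m2" "length m2 \<le> 5 ^ s"
        "\<forall>x\<in>L. final c1 m2 x = q \<or> final c1 m2 x = p" "final c1 m2 ` D \<subseteq> P"
      using large[of c1 q] m1 q unfolding c1_def by metis
    define c2 where "c2 = final c1 m2"
    obtain m3 where m3: "legal P D c2 m3" "length m3 \<le> 5 ^ s" "\<forall>x\<in>S. final c2 m3 x = q'"
        "\<forall>x\<in>L. final c2 m3 x = c2 x" "final c2 m3 ` D \<subseteq> P"
      using small[of c2 q'] m2 q' unfolding c2_def by blast
    define c3 where "c3 = final c2 m3"
    have "\<forall>x\<in>L. c3 x \<noteq> q'" using m2 m3 q' unfolding c2_def c3_def by metis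
    then obtain m4 where m4: "legal P D c3 m4" "length m4 \<le> 5 ^ s"
        "\<forall>x\<in>L. final c3 m4 x = p" "final c3 m4 ` D \<subseteq> P"
      using large[of c3 q'] m3 q' unfolding c3_def by metis
    define c4 where "c4 = final c3 m4"
    obtain m5 where m5: "legal P D c4 m5" "length m5 \<le> 5 ^ s" "\<forall>x\<in>S. final c4 m5 x = p"
        "\<forall>x\<in>L. final c4 m5 x = c4 x"
      using small[of c4 p] m4 Suc.prems(5) unfolding c4_def by blast
    let ?ms = "m1 @ m2 @ m3 @ m4 @ m5"
    have "legal P D c ?ms"
      using m1 m2 m3 m4 m5 by (simp add: legal_append c1_def c2_def c3_def c4_def)
    moreover have "length ?ms \<le> 5 ^ Suc s"
      using m1(2) m2(2) m3(2) m4(2) m5(2) by simp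
    moreover have "final c ?ms = final c4 m5"
      by (simp add: final_append c1_def c2_def c3_def c4_def)
    moreover have "\<forall>x\<in>D. final c4 m5 x = p" using m4 m5 SL(1) unfolding c4_def by auto
    ultimately show ?thesis by metis
  qed
qed


section \<open>The Hanoi Towers group and its Schreier graph\<close>

lemma hanoi_map_append:
  "set xs \<inter> {i, j} = {} \<Longrightarrow> hanoi_map i j (xs @ ys) = xs @ hanoi_map i j ys"
  by (induction xs) auto

lemma prefix_in_lists: "v \<in> boundary k \<Longrightarrow> map v [0..<n] \<in> lists {..<k}"
  by (auto simp: boundary_def)

lemma hanoi_gen_act_unaffected:
  assumes "v \<in> boundary k" "\<And>n. v n \<notin> {i, j}"
  shows "boundary_act (restrict (hanoi_map i j) (lists {..<k})) v = v"
proof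
  fix m
  have "hanoi_map i j (map v [0..<Suc m] @ []) = map v [0..<Suc m] @ hanoi_map i j []"
    using assms(2) by (intro hanoi_map_append) fastforce
  then show "boundary_act (restrict (hanoi_map i j) (lists {..<k})) v m = v m"
    using prefix_in_lists[OF assms(1), of "Suc m"] unfolding boundary_act_def
    by (simp del: upt_Suc in_lists_conv_set)
qed

lemma hanoi_gen_act_move:
  assumes "v \<in> boundary k" "\<And>m. m < n \<Longrightarrow> v m \<notin> {i, j}" "v n \<in> {i, j}"
  shows "boundary_act (restrict (hanoi_map i j) (lists {..<k})) v
    = v(n := if v n = i then j else i)"
proof
  fix m
  let ?q = "if v n = i then j else i"
  have "hanoi_map i j (map v [0..<Suc m]) ! m = (v(n := ?q)) m"
  proof (cases "m < n")
    case True
    have "v l \<notin> {i, j}" if "l \<le> m" for l using assms(2)[of l] True that by simp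
    then have "x \<notin> {i, j}" if "x \<in> set (map v [0..<Suc m])" for x
      using that by (metis atLeastLessThan_iff imageE less_Suc_eq_le set_map set_upt)
    then have "hanoi_map i j (map v [0..<Suc m] @ []) = map v [0..<Suc m] @ hanoi_map i j []"
      by (intro hanoi_map_append) blast
    then show ?thesis using True by (simp del: upt_Suc)
  next
    case False
    then have "[0..<Suc m] = [0..<n] @ [n..<Suc m]" "[n..<Suc m] = n # [Suc n..<Suc m]"
      using upt_add_eq_append[of 0 n "Suc m - n"] upt_conv_Cons[of n "Suc m"] by auto
    then have "map v [0..<Suc m] = map v [0..<n] @ v n # map v [Suc n..<Suc m]" by simp
    moreover have "hanoi_map i j (map v [0..<n] @ v n # map v [Suc n..<Suc m]) =
        map v [0..<n] @ hanoi_map i j (v n # map v [Suc n..<Suc m])"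
      using assms(2) by (intro hanoi_map_append) fastforce
    ultimately have "hanoi_map i j (map v [0..<Suc m]) =
        map v [0..<n] @ ?q # map v [Suc n..<Suc m]"
      using assms(3) by (auto simp del: upt_Suc)
    then show ?thesis using False
      by (auto simp: nth_append nth_Cons' simp del: upt_Suc)
  qed
  then show "boundary_act (restrict (hanoi_map i j) (lists {..<k})) v m = (v(n := ?q)) m"
    using prefix_in_lists[OF assms(1), of "Suc m"] unfolding boundary_act_def
    by (simp del: upt_Suc in_lists_conv_set)
qed

text \<open>Up to loops, the edges of the Schreier graph are the legal moves.\<close>

lemma hanoi_gen_act_legal:
  assumes "v \<in> boundary k" "s \<in> hanoi_gens k"
  obtains "boundary_act s v = v"
    | x where "legal {..<k} UNIV v [x]" "boundary_act s v = final v [x]"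
proof -
  obtain i j where ij: "i < j" "j < k" and s: "s = restrict (hanoi_map i j) (lists {..<k})"
    using assms(2) unfolding hanoi_gens_def by blast
  show ?thesis
  proof (cases "\<exists>n. v n \<in> {i, j}")
    case False
    then show ?thesis using hanoi_gen_act_unaffected[OF assms(1)] s that(1) by blast
  next
    case True
    define n where "n = (LEAST n. v n \<in> {i, j})"
    have n: "v n \<in> {i, j}" unfolding n_def using LeastI_ex[OF True] .
    have less: "v m \<notin> {i, j}" if "m < n" for m using not_less_Least that unfolding n_def by blast
    let ?x = "(n, if v n = i then j else i)"
    have "legal {..<k} UNIV v [?x]" using n less ij by auto
    moreover have "boundary_act s v = final v [?x]"
      using hanoi_gen_act_move[OF assms(1) less n] s by simp
    ultimately show ?thesis using that(2) by blast
  qed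
qed

lemma legal_move_hanoi_gen:
  assumes "v \<in> boundary k" "legal {..<k} UNIV v [x]"
  obtains s where "s \<in> hanoi_gens k" "boundary_act s v = final v [x]"
proof -
  obtain n q where x: "x = (n, q)" by (cases x)
  define i j where "i = min (v n) q" and "j = max (v n) q"
  have ij: "i < j" "j < k" "{i, j} = {v n, q}"
    using assms(2) unfolding i_def j_def x by (auto simp: min_def max_def)
  have "boundary_act (restrict (hanoi_map i j) (lists {..<k})) v
      = v(n := if v n = i then j else i)"
    using assms ij unfolding x by (intro hanoi_gen_act_move) auto
  also have "(if v n = i then j else i) = q" using ij by (auto simp: doubleton_eq_iff)
  finally have "boundary_act (restrict (hanoi_map i j) (lists {..<k})) v = final v [x]"
    unfolding x by (simp only: final.simps)
  moreover have "restrict (hanoi_map i j) (lists {..<k}) \<in> hanoi_gens k"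
    using ij unfolding hanoi_gens_def by blast
  ultimately show ?thesis using that by blast
qed

lemma boundary_act_prefix:
  assumes "g \<in> tree_aut k" "v \<in> boundary k"
  shows "map (boundary_act g v) [0..<n] = g (map v [0..<n])"
proof (induction n)
  case 0
  then show ?case using assms by (simp add: tree_aut_def)
next
  case (Suc n)
  have w: "map v [0..<n] \<in> lists {..<k}" "v n < k"
    using assms(2) prefix_in_lists by (auto simp: boundary_def)
  then obtain y where y: "g (map v [0..<n] @ [v n]) = g (map v [0..<n]) @ [y]"
    using assms(1) unfolding tree_aut_def by blast
  then have "boundary_act g v n = y"
    using tree_aut_length[OF assms(1) w(1)] unfolding boundary_act_def by (simp add: nth_append)
  then show ?case using Suc y by simp
qed

lemma boundary_act_mult:
  assumes "g \<in> tree_aut k" "h \<in> tree_aut k" "v \<in> boundary k"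
  shows "boundary_act (g \<otimes>\<^bsub>tree_aut_group k\<^esub> h) v = boundary_act g (boundary_act h v)"
proof
  fix n
  have "g \<in> Bij (lists {..<k})" "h \<in> Bij (lists {..<k})" using assms by (auto simp: tree_aut_def)
  then have "(g \<otimes>\<^bsub>tree_aut_group k\<^esub> h) (map v [0..<Suc n]) = g (h (map v [0..<Suc n]))"
    using prefix_in_lists[OF assms(3), of "Suc n"]
    by (simp add: tree_aut_group_def BijGroup_def compose_eq del: upt_Suc in_lists_conv_set)
  then show "boundary_act (g \<otimes>\<^bsub>tree_aut_group k\<^esub> h) v n = boundary_act g (boundary_act h v) n"
    using boundary_act_prefix[OF assms(2,3), of "Suc n"] unfolding boundary_act_def
    by (simp del: upt_Suc)
qed

lemma hanoi_group_subset: "hanoi_group k \<subseteq> tree_aut k"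
  using group.generate_incl[OF group_tree_aut_group hanoi_gens_subset]
  by (simp add: hanoi_group_def tree_aut_group_def)

lemma orbit_boundary:
  "\<xi> \<in> boundary k \<Longrightarrow> v \<in> orbit (hanoi_group k) \<xi> \<Longrightarrow> v \<in> boundary k"
  using boundary_act_in_boundary hanoi_group_subset unfolding orbit_def by blast

lemma orbit_refl:
  assumes "\<xi> \<in> boundary k"
  shows "\<xi> \<in> orbit (hanoi_group k) \<xi>"
proof -
  have "boundary_act \<one>\<^bsub>tree_aut_group k\<^esub> \<xi> n = \<xi> n" for n
    using prefix_in_lists[OF assms, of "Suc n"]
    by (simp add: boundary_act_def tree_aut_group_def BijGroup_def del: upt_Suc in_lists_conv_set)
  then have "boundary_act \<one>\<^bsub>tree_aut_group k\<^esub> \<xi> = \<xi>" by blast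
  moreover have "\<one>\<^bsub>tree_aut_group k\<^esub> \<in> hanoi_group k"
    unfolding hanoi_group_def by (rule generate.one)
  ultimately show ?thesis unfolding orbit_def by (metis imageI)
qed

lemma orbit_hanoi_gen:
  assumes "\<xi> \<in> boundary k" "v \<in> orbit (hanoi_group k) \<xi>" "s \<in> hanoi_gens k"
  shows "boundary_act s v \<in> orbit (hanoi_group k) \<xi>"
proof -
  obtain g where g: "g \<in> hanoi_group k" "v = boundary_act g \<xi>"
    using assms(2) unfolding orbit_def by blast
  have "s \<in> hanoi_group k" unfolding hanoi_group_def using assms(3) by (rule generate.incl)
  moreover from this have "s \<otimes>\<^bsub>tree_aut_group k\<^esub> g \<in> hanoi_group k"
    using g(1) unfolding hanoi_group_def by (rule generate.eng)
  moreover have "boundary_act (s \<otimes>\<^bsub>tree_aut_group k\<^esub> g) \<xi> = boundary_act s v"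
    using boundary_act_mult[of s k g \<xi>] g assms(1) hanoi_group_subset calculation(1) by blast
  ultimately show ?thesis unfolding orbit_def by (metis imageI)
qed

lemma schreier_ball_eq:
  assumes \<xi>: "\<xi> \<in> boundary k"
  shows "schreier_ball (hanoi_group k) (hanoi_gens k) \<xi> r =
    {final \<xi> ms | ms. legal {..<k} UNIV \<xi> ms \<and> real (length ms) \<le> r}"
proof -
  define R where "R = schreier_edges (hanoi_group k) (hanoi_gens k) \<xi> \<union>
    (schreier_edges (hanoi_group k) (hanoi_gens k) \<xi>)\<inverse>"
  have "final \<xi> ms \<in> orbit (hanoi_group k) \<xi> \<and> (\<xi>, final \<xi> ms) \<in> R ^^ length ms"
    if "legal {..<k} UNIV \<xi> ms" for ms
    using that
  proof (induction ms rule: rev_induct)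
    case Nil
    then show ?case using orbit_refl[OF \<xi>] by simp
  next
    case (snoc x ms)
    let ?v = "final \<xi> ms"
    have v: "?v \<in> orbit (hanoi_group k) \<xi>" "(\<xi>, ?v) \<in> R ^^ length ms"
      and x: "legal {..<k} UNIV ?v [x]"
      using snoc by (auto simp: legal_append)
    obtain s where s: "s \<in> hanoi_gens k" "boundary_act s ?v = final ?v [x]"
      using legal_move_hanoi_gen[OF orbit_boundary[OF \<xi> v(1)] x] by metis
    have "(?v, final ?v [x]) \<in> R" using v s unfolding R_def schreier_edges_def by fastforce
    then show ?case using orbit_hanoi_gen[OF \<xi> v(1) s(1)] v(2) s(2) by (auto simp: final_append)
  qed
  note reached = this
  have path: "\<exists>ms. legal {..<k} UNIV \<xi> ms \<and> length ms \<le> m \<and> final \<xi> ms = v"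
    if "(\<xi>, v) \<in> R ^^ m" for m v
    using that
  proof (induction m arbitrary: v)
    case 0
    then show ?case by (intro exI[of _ "[]"]) simp
  next
    case (Suc m)
    then obtain u where u: "(\<xi>, u) \<in> R ^^ m" "(u, v) \<in> R" by auto
    obtain ms where ms: "legal {..<k} UNIV \<xi> ms" "length ms \<le> m" "final \<xi> ms = u"
      using Suc.IH[OF u(1)] by blast
    have "\<exists>xs. legal {..<k} UNIV u xs \<and> length xs \<le> 1 \<and> final u xs = v"
    proof -
      have step: "\<exists>xs. legal {..<k} UNIV a xs \<and> length xs \<le> 1 \<and> final a xs = b"
        if ab: "(a, b) \<in> schreier_edges (hanoi_group k) (hanoi_gens k) \<xi>" for a b
      proof -
        obtain s where s: "a \<in> orbit (hanoi_group k) \<xi>" "s \<in> hanoi_gens k" "b = boundary_act s a"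
          using ab unfolding schreier_edges_def by blast
        show ?thesis
        proof (rule hanoi_gen_act_legal[OF orbit_boundary[OF \<xi> s(1)] s(2)])
          assume "boundary_act s a = a"
          then show ?thesis using s by (intro exI[of _ "[]"]) simp
        next
          fix x assume "legal {..<k} UNIV a [x]" "boundary_act s a = final a [x]"
          then show ?thesis using s by (intro exI[of _ "[x]"]) simp
        qed
      qed
      consider "(u, v) \<in> schreier_edges (hanoi_group k) (hanoi_gens k) \<xi>"
        | "(v, u) \<in> schreier_edges (hanoi_group k) (hanoi_gens k) \<xi>"
        using u(2) unfolding R_def by blast
      then show ?thesis
      proof cases
        case 1
        then show ?thesis by (rule step)
      next
        case 2
        then show ?thesis using step legal_reverse by metis
      qed
    qed
    then obtain xs where xs: "legal {..<k} UNIV u xs" "length xs \<le> 1" "final u xs = v" by blast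
    have "legal {..<k} UNIV \<xi> (ms @ xs)" "length (ms @ xs) \<le> Suc m" "final \<xi> (ms @ xs) = v"
      using ms xs by (auto simp: legal_append final_append)
    then show ?case by blast
  qed
  show ?thesis
  proof (intro equalityI subsetI)
    fix v assume "v \<in> schreier_ball (hanoi_group k) (hanoi_gens k) \<xi> r"
    then obtain m where m: "real m \<le> r" "(\<xi>, v) \<in> R ^^ m"
      unfolding schreier_ball_def R_def by blast
    then obtain ms where "legal {..<k} UNIV \<xi> ms" "length ms \<le> m" "final \<xi> ms = v"
      using path by blast
    moreover from this have "real (length ms) \<le> r" using m(1) by linarith
    ultimately show "v \<in> {final \<xi> ms | ms. legal {..<k} UNIV \<xi> ms \<and> real (length ms) \<le> r}"
      by blast
  next
    fix v assume "v \<in> {final \<xi> ms | ms. legal {..<k} UNIV \<xi> ms \<and> real (length ms) \<le> r}"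
    then obtain ms where "legal {..<k} UNIV \<xi> ms" "real (length ms) \<le> r" "v = final \<xi> ms"
      by blast
    then show "v \<in> schreier_ball (hanoi_group k) (hanoi_gens k) \<xi> r"
      using reached[of ms] unfolding schreier_ball_def R_def by blast
  qed
qed


section \<open>The size of the balls\<close>

lemma words_of_length:
  assumes "k > 0"
  shows "finite {v. (\<forall>n<N. v n < k) \<and> (\<forall>n\<ge>N. v n = 0)}"
    and "card {v. (\<forall>n<N. v n < k) \<and> (\<forall>n\<ge>N. v n = (0::nat))} = k ^ N"
proof -
  let ?W = "{v. (\<forall>n<N. v n < k) \<and> (\<forall>n\<ge>N. v n = (0::nat))}"
  let ?F = "{..<N} \<rightarrow>\<^sub>E {..<k}" and ?g = "\<lambda>f n. if n < N then f n else 0"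
  have bij: "bij_betw (\<lambda>v. restrict v {..<N}) ?W ?F"
  proof (rule bij_betw_byWitness[where f' = ?g])
    show "\<forall>v\<in>?W. ?g (restrict v {..<N}) = v" by (simp add: fun_eq_iff)
    show "\<forall>f\<in>?F. restrict (?g f) {..<N} = f"
    proof
      fix f assume f: "f \<in> ?F"
      show "restrict (?g f) {..<N} = f"
      proof
        show "restrict (?g f) {..<N} n = f n" for n
          using PiE_arb[OF f, of n] by (cases "n < N") simp_all
      qed
    qed
    show "(\<lambda>v. restrict v {..<N}) ` ?W \<subseteq> ?F" by (intro image_subsetI restrict_PiE) simp
    show "?g ` ?F \<subseteq> ?W" by (intro image_subsetI) (simp add: PiE_iff)
  qed
  show "finite ?W" using bij_betw_finite[OF bij] by (simp add: finite_PiE)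
  show "card ?W = k ^ N" using bij_betw_same_card[OF bij] by (simp add: card_PiE)
qed

lemma hanoi_ball_upper:
  assumes "k = d + 2" "r < 2 ^ s"
  defines "N \<equiv> 2 ^ (d + 1) * (s + 1) ^ d"
  shows "finite (schreier_ball (hanoi_group k) (hanoi_gens k) (\<lambda>_. 0) r)"
    and "hanoi_growth k r \<le> real k ^ N"
proof -
  let ?B = "schreier_ball (hanoi_group k) (hanoi_gens k) (\<lambda>_. 0) r"
  have \<xi>: "(\<lambda>_. 0) \<in> boundary k" using assms by (simp add: boundary_def)
  have "v n < k" "n \<ge> N \<longrightarrow> v n = 0" if vB: "v \<in> ?B" for v n
  proof -
    obtain ms where ms: "legal {..<k} UNIV (\<lambda>_. 0) ms" "real (length ms) \<le> r"
        "v = final (\<lambda>_. 0) ms"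
      using vB[unfolded schreier_ball_eq[OF \<xi>]] by blast
    show "v n < k" using final_pegs[OF ms(1)] \<xi> ms(3) by (auto simp: boundary_def)
    have "\<not> 2 ^ s \<le> length ms"
    proof
      assume "2 ^ s \<le> length ms"
      then have "(2::real) ^ s \<le> real (length ms)" by (metis of_nat_mono of_nat_numeral of_nat_power)
      then show False using ms(2) assms(2) by linarith
    qed
    moreover have "2 ^ s \<le> length ms" if "n \<ge> N" "v n \<noteq> 0"
      using moves_reaching_disk[of "{..<k}" d 0 ms n s] that ms assms(1) unfolding N_def by auto
    ultimately show "n \<ge> N \<longrightarrow> v n = 0" by blast
  qed
  then have sub: "?B \<subseteq> {v. (\<forall>n<N. v n < k) \<and> (\<forall>n\<ge>N. v n = 0)}" by blast
  have "k > 0" using assms by simp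
  show "finite ?B" using finite_subset[OF sub words_of_length(1)[OF \<open>k > 0\<close>]] .
  have "card ?B \<le> k ^ N"
    using card_mono[OF words_of_length(1)[OF \<open>k > 0\<close>] sub] words_of_length(2)[OF \<open>k > 0\<close>] by simp
  then show "hanoi_growth k r \<le> real k ^ N"
    unfolding hanoi_growth_def schreier_growth_def by (metis of_nat_mono of_nat_power)
qed

text \<open>By reversibility of the moves, gathering the disks on peg \<open>0\<close> yields paths from \<open>000...\<close> to all
  words that vanish beyond the first \<open>s choose d\<close> letters.\<close>

lemma hanoi_ball_lower:
  assumes "k = d + 2" "5 ^ s \<le> r"
  shows "real k ^ (s choose d) \<le> hanoi_growth k r"
proof -
  let ?B = "schreier_ball (hanoi_group k) (hanoi_gens k) (\<lambda>_. 0) r"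
  let ?N = "s choose d"
  have \<xi>: "(\<lambda>_. 0) \<in> boundary k" using assms by (simp add: boundary_def)
  have "k > 0" using assms by simp
  have "v \<in> ?B" if v: "\<forall>n<?N. v n < k" "\<forall>n\<ge>?N. v n = 0" for v
  proof -
    obtain ms where ms: "legal {..<k} {..<?N} v ms" "length ms \<le> 5 ^ s"
        "\<forall>n\<in>{..<?N}. final v ms n = 0"
      using gather[of "{..<?N}" "{..<k}" d s v 0] v assms by auto
    have "final v ms n = 0" for n
    proof (cases "n < ?N")
      case False
      then have "final v ms n = v n"
        using legal_moved_subset[OF ms(1)] by (intro final_unmoved) blast
      then show ?thesis using v False by simp
    qed (use ms in simp)
    then have "final v ms = (\<lambda>_. 0)" by blast
    moreover have "legal {..<k} UNIV v ms" using legal_add_larger[OF ms(1)] by auto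
    ultimately obtain ms' where ms': "legal {..<k} UNIV (\<lambda>_. 0) ms'" "length ms' = length ms"
        "final (\<lambda>_. 0) ms' = v"
      using legal_reverse by metis
    have "real (length ms) \<le> 5 ^ s" using of_nat_mono[OF ms(2), where ?'a = real] by simp
    then have "real (length ms') \<le> r" using ms'(2) assms(2) by linarith
    then show ?thesis unfolding schreier_ball_eq[OF \<xi>] using ms' by blast
  qed
  then have sub: "{v. (\<forall>n<?N. v n < k) \<and> (\<forall>n\<ge>?N. v n = 0)} \<subseteq> ?B" by blast
  obtain s' where "r < 2 ^ s'" using real_arch_pow[of 2 r] by auto
  then have "finite ?B" using hanoi_ball_upper(1)[OF assms(1)] by blast
  then have "k ^ ?N \<le> card ?B"
    using card_mono[OF _ sub] words_of_length(2)[OF \<open>k > 0\<close>] by simp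
  then show ?thesis
    unfolding hanoi_growth_def schreier_growth_def by (metis of_nat_mono of_nat_power)
qed


section \<open>Asymptotics\<close>

lemma hanoi_growth_ge_1:
  assumes "k \<ge> 2" "r \<ge> 1"
  shows "1 \<le> hanoi_growth k r"
proof -
  have "k = (k - 2) + 2" using assms by simp
  then have "real k ^ (0 choose (k - 2)) \<le> hanoi_growth k r"
    using hanoi_ball_lower[of k "k - 2" 0 r] assms(2) by simp
  moreover have "1 \<le> real k ^ (0 choose (k - 2))" using assms(1) by (intro one_le_power) simp
  ultimately show ?thesis by linarith
qed

text \<open>The radius \<open>2 ^ s\<close> is chosen with \<open>s + 1 \<le> log 2 x + 2 = log 2 (4 * x)\<close>; this is where the factor \<open>4\<close> arises.\<close>

lemma hanoi_growth_upper:
  assumes "k \<ge> 2"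
  obtains b where "b > 1"
    "\<And>x. x \<ge> 1 \<Longrightarrow> hanoi_growth k x \<le> b powr (ln (4 * x) ^ (k - 2))"
proof
  define d where "d = k - 2"
  have k: "k = d + 2" "real k > 1" using assms by (auto simp: d_def)
  define b where "b = real k powr (2 ^ (d + 1) / ln 2 ^ d)"
  show "b > 1" unfolding b_def using k by (intro gr_one_powr) auto
  show "hanoi_growth k x \<le> b powr (ln (4 * x) ^ (k - 2))" if x: "x \<ge> 1" for x
  proof -
    define s where "s = Suc (nat \<lfloor>log 2 x\<rfloor>)"
    have log0: "log 2 x \<ge> 0" using x by simp
    have "log 2 x < real s" "real s \<le> log 2 x + 1" unfolding s_def using log0 by linarith+
    have "x = 2 powr log 2 x" using x by simp
    also have "\<dots> < 2 powr real s" using \<open>log 2 x < real s\<close> by simp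
    finally have "x < 2 ^ s" by (simp add: powr_realpow)
    then have "hanoi_growth k x \<le> real k ^ (2 ^ (d + 1) * (s + 1) ^ d)"
      using hanoi_ball_upper(2)[OF k(1)] by blast
    also have "\<dots> = real k powr (2 ^ (d + 1) * real (s + 1) ^ d)"
      using k(2) by (subst powr_realpow[symmetric]) auto
    also have "\<dots> \<le> real k powr (2 ^ (d + 1) * (ln (4 * x) / ln 2) ^ d)"
    proof (intro powr_mono mult_left_mono power_mono)
      have "log 2 (2 ^ 2 * x) = 2 + log 2 x"
        using x log_pow_cancel[of 2 2] by (subst log_mult) auto
      then have "real (s + 1) \<le> log 2 (4 * x)" using \<open>real s \<le> log 2 x + 1\<close> by simp
      then show "real (s + 1) \<le> ln (4 * x) / ln 2" by (simp add: log_def)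
    qed (use k in auto)
    also have "\<dots> = b powr (ln (4 * x) ^ d)"
      unfolding b_def powr_powr by (simp add: power_divide)
    finally show ?thesis by (simp add: d_def)
  qed
qed

lemma hanoi_growth_lower:
  assumes "k \<ge> 3"
  obtains a C where "a > 1" "C > 0"
    "\<And>x. x \<ge> 1 \<Longrightarrow> a powr (ln x ^ (k - 2)) \<le> hanoi_growth k (C * x)"
proof
  define d where "d = k - 2"
  have k: "k = d + 2" "real k > 1" "d > 0" using assms by (auto simp: d_def)
  define a where "a = real k powr (1 / (d * ln 5) ^ d)"
  define C where "C = (5::real) ^ (d + 1)"
  show "a > 1" unfolding a_def using k by (intro gr_one_powr) auto
  show "C > 0" by (simp add: C_def)
  show "a powr (ln x ^ (k - 2)) \<le> hanoi_growth k (C * x)" if x: "x \<ge> 1" for x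
  proof -
    \<comment> \<open>the summand \<open>d\<close> ensures \<open>d \<le> s\<close>, as is needed to bound the binomial coefficient from below\<close>
    define s where "s = nat \<lceil>log 5 x\<rceil> + d"
    have log0: "log 5 x \<ge> 0" using x by simp
    have "log 5 x \<le> real s" "real s \<le> log 5 x + 1 + real d" "d \<le> s"
      unfolding s_def using log0 by linarith+
    have "(5::real) ^ s = 5 powr real s" by (simp add: powr_realpow)
    also have "\<dots> \<le> 5 powr (real (d + 1) + log 5 x)"
      using \<open>real s \<le> log 5 x + 1 + real d\<close> by simp
    also have "\<dots> = C * x"
      unfolding C_def powr_add using x by (subst powr_realpow) auto
    finally have C: "5 ^ s \<le> C * x" .
    have "a powr (ln x ^ d) = real k powr ((log 5 x / d) ^ d)"
      unfolding a_def powr_powr by (simp add: log_def power_divide power_mult_distrib mult.commute)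
    also have "\<dots> \<le> real k powr (real (s choose d))"
    proof (intro powr_mono)
      have "(log 5 x / d) ^ d \<le> (real s / real d) ^ d"
        using log0 \<open>log 5 x \<le> real s\<close> by (intro power_mono divide_right_mono) auto
      also have "\<dots> \<le> real (s choose d)"
        using binomial_ge_n_over_k_pow_k[OF \<open>d \<le> s\<close>, where ?'a = real] by simp
      finally show "(log 5 x / d) ^ d \<le> real (s choose d)" .
    qed (use k in auto)
    also have "\<dots> = real k ^ (s choose d)" using k by (simp add: powr_realpow)
    also have "\<dots> \<le> hanoi_growth k (C * x)" by (rule hanoi_ball_lower[OF k(1) C])
    finally show ?thesis by (simp add: d_def)
  qed
qed

lemma root_log_power_tendsto_1:
  fixes b :: real
  assumes "b > 0"
  shows "(\<lambda>n. root n (b powr (ln (4 * real n) ^ d))) \<longlonglongrightarrow> 1"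
proof -
  have "filterlim (\<lambda>n. 4 * real n) at_top sequentially"
    by (intro filterlim_tendsto_pos_mult_at_top[OF tendsto_const _ filterlim_real_sequentially]) simp
  then have "filterlim (\<lambda>n. ln (4 * real n)) at_top sequentially"
    by (rule filterlim_compose[OF ln_at_top])
  then have "(\<lambda>n. ln (4 * real n) ^ d / exp (ln (4 * real n))) \<longlonglongrightarrow> 0"
    by (rule filterlim_compose[OF tendsto_power_div_exp_0])
  then have "(\<lambda>n. exp (4 * ln b * (ln (4 * real n) ^ d / exp (ln (4 * real n)))))
      \<longlonglongrightarrow> exp (4 * ln b * 0)"
    by (intro tendsto_intros)
  moreover have "\<forall>\<^sub>F n in sequentially.
      exp (4 * ln b * (ln (4 * real n) ^ d / exp (ln (4 * real n)))) =
      root n (b powr (ln (4 * real n) ^ d))"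
    using eventually_gt_at_top[of 0]
  proof eventually_elim
    case (elim n)
    have "root n (b powr (ln (4 * real n) ^ d)) = (b powr (ln (4 * real n) ^ d)) powr (1 / n)"
      using elim assms by (simp add: root_powr_inverse)
    also have "\<dots> = exp (4 * ln b * (ln (4 * real n) ^ d / exp (ln (4 * real n))))"
      using elim assms by (simp add: powr_def)
    finally show ?case by simp
  qed
  ultimately show ?thesis by (simp add: tendsto_cong)
qed

text \<open>With \<open>C = exp L\<close> the logarithm of the right-hand side is at least \<open>ln a * (L + ln x)\<^sup>2\<close>, whose mixed term
  alone dominates \<open>m * ln x\<close> if \<open>L \<ge> m / ln a\<close>.\<close>

lemma powr_le_log_power:
  fixes a m :: real
  assumes "a > 1" "m > 0" "d \<ge> 2"
  obtains C where "C \<ge> 1" "\<And>x. x \<ge> 1 \<Longrightarrow> x powr m \<le> a powr (ln (C * x) ^ d)"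
proof
  define L where "L = max 1 (m / ln a)"
  show "exp L \<ge> 1" by (simp add: L_def)
  show "x powr m \<le> a powr (ln (exp L * x) ^ d)" if x: "x \<ge> 1" for x
  proof -
    let ?l = "ln x"
    have l: "?l \<ge> 0" using x by simp
    have L: "L \<ge> 1" "m \<le> ln a * L" using assms(1) unfolding L_def by (auto simp: max_def field_simps)
    have "m * ?l \<le> (ln a * L) * ?l" using L l by (intro mult_right_mono)
    also have "\<dots> = ln a * (L * ?l)" by simp
    also have "\<dots> \<le> ln a * (L + ?l) ^ 2"
      using assms(1) L l by (intro mult_left_mono) (auto simp: power2_eq_square algebra_simps)
    also have "\<dots> \<le> ln a * (L + ?l) ^ d"
      using assms L l by (intro mult_left_mono power_increasing) auto
    also have "L + ?l = ln (exp L * x)" using x by (simp add: ln_mult)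
    finally show ?thesis using x assms(1) by (simp add: powr_def mult.commute)
  qed
qed

theorem theorem2p1:
  fixes k :: nat
  assumes "k \<ge> 4"
  shows "intermediate_growth (hanoi_growth k) \<and>
    (\<exists>a b :: real. b > a \<and> a > 1 \<and>
      growth_le 1 (\<lambda>x. a powr (ln x ^ (k - 2))) (hanoi_growth k) \<and>
      growth_le 1 (hanoi_growth k) (\<lambda>x. b powr (ln x ^ (k - 2))))"
proof -
  have k: "k \<ge> 2" "k \<ge> 3" "k - 2 \<ge> 2" using assms by auto
  obtain b where b: "b > 1"
      "\<And>x. x \<ge> 1 \<Longrightarrow> hanoi_growth k x \<le> b powr (ln (4 * x) ^ (k - 2))"
    using hanoi_growth_upper[OF k(1)] by blast
  obtain a C where a: "a > 1" "C > 0"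
      "\<And>x. x \<ge> 1 \<Longrightarrow> a powr (ln x ^ (k - 2)) \<le> hanoi_growth k (C * x)"
    using hanoi_growth_lower[OF k(2)] by blast
  have "(\<lambda>n. root n (hanoi_growth k (real n))) \<longlonglongrightarrow> 1"
  proof (rule tendsto_sandwich[OF _ _ tendsto_const root_log_power_tendsto_1[of b "k - 2"]])
    show "\<forall>\<^sub>F n in sequentially. 1 \<le> root n (hanoi_growth k (real n))"
      using eventually_gt_at_top[of 0]
      by eventually_elim (use hanoi_growth_ge_1[OF k(1)] in \<open>simp add: real_root_ge_1_iff\<close>)
    show "\<forall>\<^sub>F n in sequentially.
        root n (hanoi_growth k (real n)) \<le> root n (b powr (ln (4 * real n) ^ (k - 2)))"
      using eventually_gt_at_top[of 0] by eventually_elim (use b in simp)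
  qed (use b in simp)
  moreover have "growth_le 0 (\<lambda>x. x powr m) (hanoi_growth k)" if m: "m > 0" for m :: real
  proof -
    obtain C' where C': "C' \<ge> 1" "\<And>x. x \<ge> 1 \<Longrightarrow> x powr m \<le> a powr (ln (C' * x) ^ (k - 2))"
      using powr_le_log_power[OF a(1) m k(3)] by blast
    have "real n powr m \<le> hanoi_growth k (C * C' * real n)" for n
    proof (cases "n = 0")
      case True
      then show ?thesis by (simp add: hanoi_growth_def schreier_growth_def)
    next
      case False
      then have n: "real n \<ge> 1" by simp
      then have "1 * 1 \<le> C' * real n" using C'(1) by (intro mult_mono) auto
      then show ?thesis using C'(2)[OF n] a(3)[of "C' * real n"] by (simp add: mult.assoc)
    qed
    moreover have "C * C' > 0" using a C' by simp
    ultimately show ?thesis unfolding growth_le_def by blast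
  qed
  ultimately have "intermediate_growth (hanoi_growth k)"
    unfolding intermediate_growth_def by blast
  moreover have "growth_le 1 (\<lambda>x. a powr (ln x ^ (k - 2))) (hanoi_growth k)"
    unfolding growth_le_def using a by (intro exI[of _ C]) auto
  \<comment> \<open>enlarging \<open>b\<close> makes it exceed \<open>a\<close>\<close>
  moreover have "growth_le 1 (hanoi_growth k) (\<lambda>x. max b (a + 1) powr (ln x ^ (k - 2)))"
    unfolding growth_le_def
  proof (intro exI[of _ 4] conjI allI impI)
    fix n :: nat
    assume "n \<ge> 1"
    then have "hanoi_growth k (real n) \<le> b powr (ln (4 * real n) ^ (k - 2))"
      using b(2)[of "real n"] by simp
    also have "\<dots> \<le> max b (a + 1) powr (ln (4 * real n) ^ (k - 2))"
      using b(1) \<open>n \<ge> 1\<close> by (intro powr_mono2) auto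
    finally show "hanoi_growth k (real n) \<le> max b (a + 1) powr (ln (4 * real n) ^ (k - 2))" .
  qed simp
  moreover have "max b (a + 1) > a" by simp
  ultimately show ?thesis using a(1) by blast
qed

end
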